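(* Let $0<\varphi\le\frac{\pi}{2}$, $c=\cos\varphi$, $s=\sin\varphi=\sqrt{1-c^2}$. Let $k=2\sqrt{\frac{2\sqrt2-1}{7}}$, $\tilde u=kc^2-(2k-3)c+k$, and $\mathcal{D}=(3c,\tilde u)\times[8-5c,\infty)$. Then the optimal quartic $G^1$ outer approximant of the circular arc $\alpha\mapsto(\cos\alpha,\sin\alpha)^T$, $\alpha\in[-\varphi,\varphi]$, is given by the unique solution $(u^\land,v^\land)$ on the domain $\mathcal{D}$ of the nonlinear algebraic system $$\psi_{uv}(\sqrt2-1,u,v)=0,\qquad \psi_{uv}'(\sqrt2-1,u,v)=0,$$ where $'$ denotes the derivative with respect to $t$; that is, by the parameters $\xi=\frac{v^\land-u^\land}{8\sqrt{1-c^2}}$, $\eta=\frac{u^\land+v^\land}{6}$.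
   Context: For real $\xi>0$ and $\eta\in\mathbb{R}$, the quartic $G^1$ approximant with parameters $(\xi,\eta)$ is the curve $p:[-1,1]\to\mathbb{R}^2$, $p(t)=\sum_{i=0}^4\binom{4}{i}\left(\frac{1+t}{2}\right)^i\left(\frac{1-t}{2}\right)^{4-i}b_i$, with control points $b_0=(c,-s)^T$, $b_1=(c,-s)^T+\xi(s,c)^T$, $b_2=(\eta,0)^T$, $b_3=(c,s)^T+\xi(s,-c)^T$, $b_4=(c,s)^T$. Its simplified radial error function is the polynomial $\psi(t,\xi,\eta)=\|p(t)\|_2^2-1$ in $t$ (defined by the same formula for all real $\xi,\eta$). In the variables $u=3\eta-4\sqrt{1-c^2}\,\xi$, $v=3\eta+4\sqrt{1-c^2}\,\xi$, i.e. $\xi=\frac{v-u}{8\sqrt{1-c^2}}$, $\eta=\frac{u+v}{6}$, one writes $\psi_{uv}(t,u,v)=\psi\bigl(t,\frac{v-u}{8\sqrt{1-c^2}},\frac{u+v}{6}\bigr)$. The approximant is called outer if $\psi(t,\xi,\eta)\ge 0$ for all $t\in[-1,1]$. An outer approximant is optimal if it minimizes $\max_{t\in[-1,1]}|\psi(t,\xi,\eta)|$ among all outer approximants of this form (all $\xi>0$, $\eta\in\mathbb{R}$ giving an outer approximant).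
   Formalization: At φ = π/2 the solution has u = ũ = k exactly, so the printed open domain D contains no solution there; for φ = π/2 only, the interval (3c, ũ) is replaced by (3c, ũ]. *)

theory Defs
  imports "HOL-Analysis.Analysis"
begin

text \<open>
  Quartic \<open>G\<^sup>1\<close> approximants of the arc \<open>\<alpha> \<mapsto> (cos \<alpha>, sin \<alpha>)\<close>, \<open>\<alpha> \<in> [-\<phi>, \<phi>]\<close>. The half-angle
  \<open>\<phi>\<close> is a parameter of all definitions, with \<open>c = cos \<phi>\<close> and \<open>s = sin \<phi>\<close>.
\<close>

definition control_point :: "real \<Rightarrow> real \<Rightarrow> real \<Rightarrow> nat \<Rightarrow> real ^ 2" where
  "control_point \<phi> \<xi> \<eta> i =
     (let c = cos \<phi>; s = sin \<phi> in
       [vector [c, - s],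
        vector [c, - s] + \<xi> *\<^sub>R vector [s, c],
        vector [\<eta>, 0],
        vector [c, s] + \<xi> *\<^sub>R vector [s, - c],
        vector [c, s]] ! i)"

definition quartic_curve :: "real \<Rightarrow> real \<Rightarrow> real \<Rightarrow> real \<Rightarrow> real ^ 2" where
  "quartic_curve \<phi> \<xi> \<eta> t =
     (\<Sum>i\<le>4. (real (4 choose i) * ((1 + t) / 2) ^ i * ((1 - t) / 2) ^ (4 - i))
             *\<^sub>R control_point \<phi> \<xi> \<eta> i)"

definition psi :: "real \<Rightarrow> real \<Rightarrow> real \<Rightarrow> real \<Rightarrow> real" where
  "psi \<phi> t \<xi> \<eta> = (norm (quartic_curve \<phi> \<xi> \<eta> t))\<^sup>2 - 1"

definition xi_of :: "real \<Rightarrow> real \<Rightarrow> real \<Rightarrow> real" where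
  "xi_of \<phi> u v = (v - u) / (8 * sqrt (1 - (cos \<phi>)\<^sup>2))"

definition eta_of :: "real \<Rightarrow> real \<Rightarrow> real" where
  "eta_of u v = (u + v) / 6"

definition psi_uv :: "real \<Rightarrow> real \<Rightarrow> real \<Rightarrow> real \<Rightarrow> real" where
  "psi_uv \<phi> t u v = psi \<phi> t (xi_of \<phi> u v) (eta_of u v)"

definition outer_approximant :: "real \<Rightarrow> real \<Rightarrow> real \<Rightarrow> bool" where
  "outer_approximant \<phi> \<xi> \<eta> \<longleftrightarrow> \<xi> > 0 \<and> (\<forall>t\<in>{-1..1}. psi \<phi> t \<xi> \<eta> \<ge> 0)"

text \<open>The supremum is a maximum, since \<open>\<psi>\<close> is continuous in \<open>t\<close>.\<close>

definition max_radial_error :: "real \<Rightarrow> real \<Rightarrow> real \<Rightarrow> real" where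
  "max_radial_error \<phi> \<xi> \<eta> = (SUP t\<in>{-1..1}. \<bar>psi \<phi> t \<xi> \<eta>\<bar>)"

definition optimal_outer_approximant :: "real \<Rightarrow> real \<Rightarrow> real \<Rightarrow> bool" where
  "optimal_outer_approximant \<phi> \<xi> \<eta> \<longleftrightarrow>
     outer_approximant \<phi> \<xi> \<eta> \<and>
     (\<forall>\<xi>' \<eta>'. outer_approximant \<phi> \<xi>' \<eta>' \<longrightarrow>
        max_radial_error \<phi> \<xi> \<eta> \<le> max_radial_error \<phi> \<xi>' \<eta>')"

definition k_const :: real where
  "k_const = 2 * sqrt ((2 * sqrt 2 - 1) / 7)"

definition u_tilde :: "real \<Rightarrow> real" where
  "u_tilde \<phi> = k_const * (cos \<phi>)\<^sup>2 - (2 * k_const - 3) * cos \<phi> + k_const"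

text \<open>
  For \<open>\<phi> < \<pi>/2\<close> this is \<open>(3c, u_tilde) \<times> [8 - 5c, \<infinity>)\<close>. For the semicircle, \<open>\<phi> = \<pi>/2\<close>, the point
  \<open>u = u_tilde = k_const\<close> must be included: with \<open>c = 0\<close> and \<open>r = (sqrt 2 - 1)\<^sup>2\<close>, the system
  \<open>\<psi> = \<psi>' = 0\<close> at \<open>t = sqrt 2 - 1\<close> reads \<open>v\<^sup>2 = 64 + r\<^sup>2 u\<^sup>2\<close>, \<open>u v = 8 + r u\<^sup>2\<close>, hence
  \<open>u\<^sup>2 = 4 / (4 - r) = k_const\<^sup>2\<close>, so it has no solution on the open interval.
\<close>

definition solution_domain :: "real \<Rightarrow> (real \<times> real) set" where
  "solution_domain \<phi> =
     (if \<phi> = pi / 2 then {3 * cos \<phi> <.. u_tilde \<phi>} else {3 * cos \<phi> <..< u_tilde \<phi>})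
       \<times> {8 - 5 * cos \<phi> ..}"

end

theory Submission
  imports Defs
begin

text \<open>
  With \<open>q = 1 - t\<^sup>2\<close> and \<open>D = (u - 3 c) / 8\<close> one has \<open>\<psi> = q\<^sup>2 h(q)\<close>, where \<open>h\<close> is a quadratic
  polynomial with leading coefficient \<open>D\<^sup>2\<close>. The system says that \<open>h = D\<^sup>2 (q - r)\<^sup>2\<close> for
  \<open>r = 2 sqrt 2 - 2\<close>, and \<open>q\<^sup>2 (q - r)\<^sup>2\<close> has the smallest maximum on \<open>[0, 1]\<close> among the nonnegative
  \<open>q\<^sup>2 (q\<^sup>2 + b q + a)\<close>. So an outer approximant can only compete if its leading coefficient
  \<open>D'\<close> satisfies \<open>\<bar>D'\<bar> \<le> D\<close>; but then \<open>h'(r) \<ge> 0 = h(r)\<close> forces \<open>h'(r / 2) > h(r / 2)\<close> unless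
  \<open>D' = D\<close>. Every solution in the domain is therefore the unique optimum, which
  also gives uniqueness of the solution. Existence follows from the intermediate value theorem
  after the scaling \<open>s \<xi> = (1 - c) m\<close>, \<open>D = (1 - c)\<^sup>2 x\<close> with \<open>0 \<le> x \<le> k / 8\<close>.
\<close>

section \<open>The radial error as a polynomial in one variable\<close>

text \<open>The factor \<open>h\<close> in \<open>\<psi> = q\<^sup>2 h(q)\<close>. Taking
  \<open>c\<close> and \<open>s\<close> as arguments lets the estimates treat them as plain reals
  tied by \<open>c\<^sup>2 + s\<^sup>2 = 1\<close>.\<close>

definition quot :: "real \<Rightarrow> real \<Rightarrow> real \<Rightarrow> real \<Rightarrow> real \<Rightarrow> real" where
  "quot c s \<xi> D q = (\<xi>\<^sup>2 + c * s * \<xi> + 2 * c * D - 3 * s\<^sup>2 / 4)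
     + (2 * s * \<xi> * D - (s / 2 - c * \<xi>)\<^sup>2) * q + D\<^sup>2 * q\<^sup>2"

text \<open>The coefficient of \<open>q\<^sup>2\<close> in the first coordinate of the curve; in the
  variables \<open>u\<close>, \<open>v\<close> it is \<open>(u - 3 c) / 8\<close>.\<close>

definition quad_coeff :: "real \<Rightarrow> real \<Rightarrow> real \<Rightarrow> real" where
  "quad_coeff \<phi> \<xi> \<eta> = (3 * \<eta> - 3 * cos \<phi> - 4 * \<xi> * sin \<phi>) / 8"

text \<open>The control polygon is symmetric about the x-axis, so the first coordinate is even in
  \<open>t\<close> and the second odd; up to a factor \<open>t\<close> both are polynomials in
  \<open>q\<close>.\<close>

lemma quartic_curve_components:
  fixes \<phi> \<xi> \<eta> t :: real
  defines "c \<equiv> cos \<phi>" and "s \<equiv> sin \<phi>" and "D \<equiv> quad_coeff \<phi> \<xi> \<eta>" and "q \<equiv> 1 - t\<^sup>2"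
  shows "quartic_curve \<phi> \<xi> \<eta> t $ 1 = c + s * \<xi> * q + D * q\<^sup>2"
    and "quartic_curve \<phi> \<xi> \<eta> t $ 2 = t * (s + q * (s / 2 - c * \<xi>))"
proof -
  have ch: "4 choose 2 = (6::nat)" "4 choose 3 = (4::nat)"
    by (simp_all add: numeral_eq_Suc)
  show "quartic_curve \<phi> \<xi> \<eta> t $ 1 = c + s * \<xi> * q + D * q\<^sup>2"
    unfolding quartic_curve_def control_point_def assms quad_coeff_def Let_def
    by (simp add: atMost_nat_numeral ch eval_nat_numeral field_simps)
  show "quartic_curve \<phi> \<xi> \<eta> t $ 2 = t * (s + q * (s / 2 - c * \<xi>))"
    unfolding quartic_curve_def control_point_def assms quad_coeff_def Let_def
    by (simp add: atMost_nat_numeral ch eval_nat_numeral field_simps)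
qed

text \<open>The curve starts and ends on the unit circle, tangent to it, so \<psi> has double zeros
  at both ends; they give the factor \<open>(1 - t\<^sup>2)\<^sup>2\<close>.\<close>

lemma psi_eq_quot:
  "psi \<phi> t \<xi> \<eta> = (1 - t\<^sup>2)\<^sup>2 * quot (cos \<phi>) (sin \<phi>) \<xi> (quad_coeff \<phi> \<xi> \<eta>) (1 - t\<^sup>2)"
proof -
  define c s D where "c = cos \<phi>" and "s = sin \<phi>" and "D = quad_coeff \<phi> \<xi> \<eta>"
  have cs: "c\<^sup>2 + s\<^sup>2 = 1" by (simp add: c_def s_def)
  have "psi \<phi> t \<xi> \<eta> = (quartic_curve \<phi> \<xi> \<eta> t $ 1)\<^sup>2 + (quartic_curve \<phi> \<xi> \<eta> t $ 2)\<^sup>2 - 1"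
    unfolding psi_def power2_norm_eq_inner inner_vec_def by (simp add: sum_2 power2_eq_square)
  also have "\<dots> = (1 - t\<^sup>2)\<^sup>2 * quot c s \<xi> D (1 - t\<^sup>2)"
  proof -
    \<comment> \<open>Halving \<open>s\<close> clears the denominators and leaves a polynomial
      identity modulo \<open>c\<^sup>2 + s\<^sup>2 = 1\<close>.\<close>
    obtain \<sigma> where \<sigma>: "s = 2 * \<sigma>" by (metis field_sum_of_halves mult_2)
    have "3 * (2 * \<sigma>)\<^sup>2 / 4 = 3 * \<sigma>\<^sup>2" "2 * \<sigma> / 2 = \<sigma>"
      by (simp_all add: power2_eq_square)
    then show ?thesis
      unfolding quartic_curve_components quot_def c_def[symmetric] s_def[symmetric] D_def[symmetric]
      using cs unfolding \<sigma> by algebra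
  qed
  finally show ?thesis unfolding c_def s_def D_def .
qed

lemma psi_extremal:
  assumes "\<And>q. quot (cos \<phi>) (sin \<phi>) \<xi> (quad_coeff \<phi> \<xi> \<eta>) q = (quad_coeff \<phi> \<xi> \<eta>)\<^sup>2 * (q - r)\<^sup>2"
  shows "psi \<phi> t \<xi> \<eta> = (quad_coeff \<phi> \<xi> \<eta>)\<^sup>2 * ((1 - t\<^sup>2) * (1 - t\<^sup>2 - r))\<^sup>2"
  unfolding psi_eq_quot assms by (simp add: power_mult_distrib)

lemma psi_le_max_radial_error:
  assumes "t \<in> {-1..1}"
  shows "\<bar>psi \<phi> t \<xi> \<eta>\<bar> \<le> max_radial_error \<phi> \<xi> \<eta>"
proof -
  have "continuous_on {-1..1} (\<lambda>t. \<bar>psi \<phi> t \<xi> \<eta>\<bar>)"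
    unfolding psi_eq_quot quot_def by (intro continuous_intros)
  then have "bdd_above ((\<lambda>t. \<bar>psi \<phi> t \<xi> \<eta>\<bar>) ` {-1..1})"
    by (intro bounded_imp_bdd_above compact_imp_bounded compact_continuous_image) auto
  then show ?thesis
    unfolding max_radial_error_def using assms by (rule cSUP_upper2) auto
qed

lemma quot_le_max_radial_error:
  assumes "0 \<le> q" "q \<le> 1"
  shows "q\<^sup>2 * quot (cos \<phi>) (sin \<phi>) \<xi> (quad_coeff \<phi> \<xi> \<eta>) q \<le> max_radial_error \<phi> \<xi> \<eta>"
proof -
  have "sqrt (1 - q) \<in> {-1..1}"
    using assms by (auto intro: order_trans[of _ 0])
  from psi_le_max_radial_error[OF this, of \<phi> \<xi> \<eta>] show ?thesis
    unfolding psi_eq_quot using assms by simp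
qed

lemma outer_quot_nonneg:
  assumes "outer_approximant \<phi> \<xi> \<eta>" "0 < q" "q \<le> 1"
  shows "0 \<le> quot (cos \<phi>) (sin \<phi>) \<xi> (quad_coeff \<phi> \<xi> \<eta>) q"
proof -
  have "sqrt (1 - q) \<in> {-1..1}"
    using assms by (auto intro: order_trans[of _ 0])
  then have "psi \<phi> (sqrt (1 - q)) \<xi> \<eta> \<ge> 0"
    using assms(1) unfolding outer_approximant_def by blast
  then show ?thesis
    unfolding psi_eq_quot using assms by (simp add: zero_le_mult_iff)
qed

section \<open>Comparison of approximants\<close>

text \<open>The signs force the slope to be both nonnegative and nonpositive. It is applied at
  \<open>r / 2 < r < 1\<close> to the affine part of a competitor.\<close>

lemma linear_sandwich_zero:
  fixes a b x y z :: real
  assumes "x < y" "y < z"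
    and "a + b * x \<le> 0" "0 \<le> a + b * y" "a + b * z \<le> 0"
  shows "a = 0 \<and> b = 0"
proof -
  have 1: "0 \<le> b * (y - x)" and 2: "b * (z - y) \<le> 0"
    using assms(3-5) by (simp_all add: algebra_simps)
  from 1 2 have "b = 0"
    using assms(1,2) by (smt (verit) mult_neg_pos mult_pos_pos)
  then show ?thesis using assms by simp
qed

text \<open>
  For fixed \<open>q\<close> the change of \<open>quot\<close> between two parameter pairs is exactly its differential at
  their midpoint. The ratio of the two partial derivatives there is monotone in \<open>q\<close>, so a
  gain at \<open>q\<close> after decreasing \<open>D\<close> forces a gain at every smaller \<open>p\<close>.
\<close>

lemma quot_exchange:
  fixes c s :: real
  assumes cs: "0 \<le> c" "0 < s" "c\<^sup>2 + s\<^sup>2 = 1"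
    and pos: "0 < \<xi>" "0 < \<xi>'" and D: "- D \<le> D'" "D' < D" and D_le: "D \<le> \<xi> / s - c / 2"
    and pq: "0 < p" "p < q" "q \<le> 1"
    and ge: "quot c s \<xi> D q \<le> quot c s \<xi>' D' q"
  shows "quot c s \<xi> D p < quot c s \<xi>' D' p"
proof -
  define X Y where "X = (\<xi> + \<xi>') / 2" and "Y = (D + D') / 2"
  \<comment> \<open>\<open>a + b * r\<close> and \<open>H r\<close> are the partial derivatives of
    \<open>quot\<close> in \<open>\<xi>\<close> and in \<open>D\<close> at the midpoint
    \<open>(X, Y)\<close>. The midpoint rule is exact because \<open>quot\<close> is quadratic in
    \<open>(\<xi>, D)\<close>.\<close>
  define a b where "a = 2 * X + c * s" and "b = c * s - 2 * X * c\<^sup>2 + 2 * s * Y"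
  define H where "H r = 2 * (c + s * X * r + Y * r\<^sup>2)" for r
  have X: "0 < X" and Y: "0 \<le> Y" "Y < D" using pos D by (auto simp: X_def Y_def)
  have diff: "quot c s \<xi>' D' r - quot c s \<xi> D r = (a + b * r) * (\<xi>' - \<xi>) - H r * (D - D')" for r
    unfolding quot_def a_def b_def H_def X_def Y_def
    by (simp add: field_simps power2_eq_square)
  have Hpos: "H r > 0" if "0 < r" for r
    using that X Y cs unfolding H_def by (intro mult_pos_pos add_nonneg_pos add_pos_nonneg) auto
  have c2: "c\<^sup>2 < 1" using cs(2,3) by (smt (verit) zero_less_power2)
  have apos: "a + b * r > 0" if "0 < r" "r \<le> 1" for r
  proof -
    have "c\<^sup>2 * r \<le> c\<^sup>2" using that by (intro mult_left_le) auto
    then have "0 < 2 * X * (1 - c\<^sup>2 * r)" using c2 X by simp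
    moreover have "0 \<le> c * s * (1 + r) + 2 * s * Y * r" using cs Y that by simp
    ultimately show ?thesis unfolding a_def b_def by (simp add: algebra_simps)
  qed
  have "0 < H q * (D - D')" using Hpos[of q] pq D by simp
  then have "0 < (a + b * q) * (\<xi>' - \<xi>)" using diff[of q] ge by linarith
  then have inc: "\<xi> < \<xi>'" using apos[of q] pq by (simp add: zero_less_mult_iff)
  \<comment> \<open>The bound \<open>D_le\<close> moved to the midpoint: since
    \<open>\<xi> < X\<close>, it gives \<open>Y < g\<close>. Writing \<open>X\<close> through
    \<open>g\<close> makes \<open>a * s * X - b * c\<close>, whose sign is not evident, a sum of
    nonnegative terms with one positive.\<close>
  define g where "g = X / s - c / 2"
  have "\<xi> / s \<le> X / s" using inc cs unfolding X_def by (intro divide_right_mono) auto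
  then have g: "Y < g" using Y D_le unfolding g_def by linarith
  have Xg: "X = s * (g + c / 2)" using cs unfolding g_def by simp
  have "a * s * X - b * c = s * (2 * s\<^sup>2 * g\<^sup>2 + c * g * (3 - c\<^sup>2) - 2 * c * Y)"
  proof -
    obtain k where k: "c = 2 * k" by (metis field_sum_of_halves mult_2)
    then have "X = s * (g + k)" unfolding Xg by simp
    then show ?thesis unfolding a_def b_def using cs(3) unfolding k by algebra
  qed
  moreover have "c * g * (3 - c\<^sup>2) - 2 * c * Y = c * (2 * (g - Y) + g * (1 - c\<^sup>2))"
    by (simp add: algebra_simps)
  moreover have "0 \<le> c * (2 * (g - Y) + g * (1 - c\<^sup>2))"
    using cs g Y c2 by simp
  moreover have "0 < 2 * s\<^sup>2 * g\<^sup>2" using cs g Y by simp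
  ultimately have "a * s * X - b * c = s * (2 * s\<^sup>2 * g\<^sup>2 + c * g * (3 - c\<^sup>2) - 2 * c * Y)"
    and "0 < 2 * s\<^sup>2 * g\<^sup>2 + c * g * (3 - c\<^sup>2) - 2 * c * Y"
    by linarith+
  then have 1: "0 < a * s * X - b * c" using cs by simp
  have "0 \<le> a" using X cs unfolding a_def by simp
  then have "0 \<le> a * q + p * (a + b * q)" using apos[of q] pq by simp
  then have 2: "0 \<le> Y * (a * q + p * (a + b * q))" using Y by simp
  \<comment> \<open>Cross-multiplied monotonicity of \<open>H r / (a + b * r)\<close>; the factor
    \<open>q - p\<close> splits off.\<close>
  have "(a + b * p) * H q - (a + b * q) * H p
      = 2 * (q - p) * (a * s * X - b * c + Y * (a * q + p * (a + b * q)))"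
    unfolding H_def by algebra
  also have "\<dots> > 0" using 1 2 pq by simp
  finally have cross: "(a + b * q) * H p < (a + b * p) * H q" by simp
  have "(a + b * q) * (H p * (D - D')) < (a + b * p) * (H q * (D - D'))"
    using cross D by (simp flip: mult.assoc)
  also have "\<dots> \<le> (a + b * p) * ((a + b * q) * (\<xi>' - \<xi>))"
    using diff[of q] ge apos[of p] pq by (intro mult_left_mono) auto
  finally have "(a + b * q) * (H p * (D - D')) < (a + b * q) * ((a + b * p) * (\<xi>' - \<xi>))"
    by (simp add: mult_ac)
  then show ?thesis using diff[of p] apos[of q] pq by simp
qed

text \<open>
  The condition \<open>r\<^sup>2 = 4 - 4 r\<close>, satisfied by \<open>r = 2 sqrt 2 - 2\<close>, says that \<open>\<bar>q (q - r)\<bar>\<close>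
  takes the same value at its critical point \<open>r / 2\<close> and at the end point \<open>1\<close>.
\<close>

lemma extremal_bound:
  fixes q r :: real
  assumes r: "r\<^sup>2 = 4 - 4 * r" "0 < r" "r < 1" and q: "0 \<le> q" "q \<le> 1"
  shows "(q * (q - r))\<^sup>2 \<le> (1 - r)\<^sup>2"
proof -
  have "q * (q - r) + (1 - r) = (q - r / 2)\<^sup>2"
    using r(1) by (simp add: power2_eq_square field_simps)
  then have "- (1 - r) \<le> q * (q - r)" by (smt (verit) zero_le_power2)
  moreover have "q * (q - r) \<le> 1 - r"
  proof -
    have "(1 - q) * (1 + q - r) \<ge> 0" using q r by simp
    then show ?thesis by (simp add: algebra_simps)
  qed
  ultimately show ?thesis using r by (intro abs_le_square_iff[THEN iffD1]) auto
qed

lemma optimal_outer_unique: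
  fixes \<phi> \<xi> \<eta> r :: real
  defines "c \<equiv> cos \<phi>" and "s \<equiv> sin \<phi>" and "D \<equiv> quad_coeff \<phi> \<xi> \<eta>"
  assumes cs: "0 \<le> c" "0 < s" and r: "r\<^sup>2 = 4 - 4 * r" "0 < r" "r < 1"
    and pos: "0 < \<xi>" "0 < D" and D_le: "D \<le> \<xi> / s - c / 2"
    and root: "\<And>q. quot c s \<xi> D q = D\<^sup>2 * (q - r)\<^sup>2"
  shows "{(\<xi>', \<eta>'). optimal_outer_approximant \<phi> \<xi>' \<eta>'} = {(\<xi>, \<eta>)}"
proof -
  \<comment> \<open>The maximum of \<open>D\<^sup>2 (q (q - r))\<^sup>2\<close> on
    \<open>[0, 1]\<close>, attained at \<open>r / 2\<close> and at \<open>1\<close>. Competitors are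
    tested at these two points and at the contact point \<open>r\<close>.\<close>
  define M where "M = D\<^sup>2 * (1 - r)\<^sup>2"
  have cs1: "c\<^sup>2 + s\<^sup>2 = 1" by (simp add: c_def s_def)
  note psi = psi_extremal[OF root[unfolded c_def s_def D_def]]
  have outer: "outer_approximant \<phi> \<xi> \<eta>"
    using pos unfolding outer_approximant_def psi by simp
  have M_ge: "max_radial_error \<phi> \<xi> \<eta> \<le> M"
    unfolding max_radial_error_def
  proof (rule cSUP_least)
    fix t :: real assume "t \<in> {-1..1}"
    then have "t\<^sup>2 \<le> 1" by (simp add: abs_square_le_1 abs_le_iff)
    then have "((1 - t\<^sup>2) * (1 - t\<^sup>2 - r))\<^sup>2 \<le> (1 - r)\<^sup>2"
      by (intro extremal_bound r) auto
    then show "\<bar>psi \<phi> t \<xi> \<eta>\<bar> \<le> M"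
      unfolding psi M_def D_def by (simp add: mult_left_mono)
  qed auto
  have half: "(r / 2)\<^sup>2 * (r / 2 - r)\<^sup>2 = (1 - r)\<^sup>2"
  proof -
    have "(r / 2)\<^sup>2 = 1 - r" "(r / 2 - r)\<^sup>2 = 1 - r"
      using r(1) by (simp_all add: power2_eq_square field_simps)
    then show ?thesis by (simp only: power2_eq_square[of "1 - r"])
  qed
  \<comment> \<open>Optimality and uniqueness both reduce to this claim.\<close>
  have key: "\<xi>' = \<xi> \<and> \<eta>' = \<eta>"
    if o: "outer_approximant \<phi> \<xi>' \<eta>'" and le: "max_radial_error \<phi> \<xi>' \<eta>' \<le> M" for \<xi>' \<eta>'
  proof -
    define D' where "D' = quad_coeff \<phi> \<xi>' \<eta>'"
    define A B where "A = \<xi>'\<^sup>2 + c * s * \<xi>' + 2 * c * D' - 3 * s\<^sup>2 / 4"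
      and "B = 2 * s * \<xi>' * D' - (s / 2 - c * \<xi>')\<^sup>2"
    have \<xi>': "0 < \<xi>'" using o by (simp add: outer_approximant_def)
    have Q: "quot c s \<xi>' D' q = A + B * q + D'\<^sup>2 * q\<^sup>2" for q
      unfolding quot_def A_def B_def by simp
    have up: "q\<^sup>2 * quot c s \<xi>' D' q \<le> M" if "0 \<le> q" "q \<le> 1" for q
      using quot_le_max_radial_error[OF that, of \<phi> \<xi>' \<eta>'] le
      unfolding c_def s_def D'_def by linarith
    have low: "0 \<le> quot c s \<xi>' D' r"
      using outer_quot_nonneg[OF o, of r] r unfolding c_def s_def D'_def by simp
    have not_between: "\<not> (- D \<le> D' \<and> D' < D)"
    proof
      assume *: "- D \<le> D' \<and> D' < D"
      have "quot c s \<xi> D (r / 2) < quot c s \<xi>' D' (r / 2)"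
        using * low root[of r] r pos \<xi>' cs
        by (intro quot_exchange[OF cs cs1 pos(1) \<xi>' _ _ D_le, of D' "r / 2" r]) auto
      then have "(r / 2)\<^sup>2 * quot c s \<xi> D (r / 2) < (r / 2)\<^sup>2 * quot c s \<xi>' D' (r / 2)"
        using r by (intro mult_strict_left_mono) auto
      moreover have "(r / 2)\<^sup>2 * quot c s \<xi> D (r / 2) = M"
        unfolding root M_def half[symmetric] by simp
      ultimately show False using up[of "r / 2"] r by simp
    qed
    then have sq: "D\<^sup>2 \<le> D'\<^sup>2"
      using pos by (intro abs_le_square_iff[THEN iffD1]) auto
    \<comment> \<open>Subtracting \<open>D'\<^sup>2 (q - r)\<^sup>2\<close> leaves the affine part
      \<open>a + b q\<close>. It is nonpositive at \<open>r / 2\<close> and \<open>1\<close>, where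
      the subtracted term alone already yields at least \<open>M\<close>, and nonnegative at
      \<open>r\<close> because the competitor is outer.\<close>
    define a b where "a = A - D'\<^sup>2 * r\<^sup>2" and "b = B + 2 * D'\<^sup>2 * r"
    have lin: "quot c s \<xi>' D' q = (a + b * q) + D'\<^sup>2 * (q - r)\<^sup>2" for q
      unfolding Q a_def b_def by algebra
    have drop: "M \<le> D'\<^sup>2 * (1 - r)\<^sup>2"
      unfolding M_def using sq by (intro mult_right_mono) auto
    have "(r / 2)\<^sup>2 * (a + b * (r / 2)) + D'\<^sup>2 * (1 - r)\<^sup>2 = (r / 2)\<^sup>2 * quot c s \<xi>' D' (r / 2)"
      unfolding lin half[symmetric] by (simp add: algebra_simps)
    then have "(r / 2)\<^sup>2 * (a + b * (r / 2)) \<le> 0"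
      using up[of "r / 2"] r drop by linarith
    then have 1: "a + b * (r / 2) \<le> 0" using r by (simp add: mult_le_0_iff)
    have 2: "a + b * 1 \<le> 0" using up[of 1] drop unfolding lin by simp
    have 3: "0 \<le> a + b * r" using low unfolding lin by simp
    have ab: "a = 0 \<and> b = 0"
      using linear_sandwich_zero[OF _ r(3) 1 3 2] r by simp
    have "D'\<^sup>2 * (1 - r)\<^sup>2 \<le> M" using up[of 1] ab unfolding lin by simp
    then have "D'\<^sup>2 \<le> D\<^sup>2" unfolding M_def using r by simp
    with sq have "D'\<^sup>2 = D\<^sup>2" by simp
    then have DD: "D' = D" using not_between pos by (auto simp: power2_eq_iff)
    \<comment> \<open>For fixed \<open>D\<close> the constant coefficient is strictly increasing in
      positive \<open>\<xi>\<close>, so it determines \<open>\<xi>\<close>.\<close>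
    have "quot c s \<xi>' D 0 = quot c s \<xi> D 0"
      using lin[of 0] ab root[of 0] unfolding DD by simp
    then have "(\<xi>' - \<xi>) * (\<xi>' + \<xi> + c * s) = 0"
      unfolding quot_def by (simp add: algebra_simps power2_eq_square)
    moreover have "\<xi>' + \<xi> + c * s > 0" using \<xi>' pos cs by (simp add: add_pos_nonneg)
    ultimately have "\<xi>' = \<xi>" by simp
    with DD show ?thesis unfolding D'_def D_def quad_coeff_def by simp
  qed
  have opt: "optimal_outer_approximant \<phi> \<xi> \<eta>"
    unfolding optimal_outer_approximant_def
  proof (intro conjI allI impI outer)
    fix \<xi>' \<eta>' assume o: "outer_approximant \<phi> \<xi>' \<eta>'"
    show "max_radial_error \<phi> \<xi> \<eta> \<le> max_radial_error \<phi> \<xi>' \<eta>'"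
    proof (cases "max_radial_error \<phi> \<xi>' \<eta>' \<le> M")
      case True with key[OF o] show ?thesis by simp
    next
      case False with M_ge show ?thesis by linarith
    qed
  qed
  have "\<xi>' = \<xi> \<and> \<eta>' = \<eta>" if "optimal_outer_approximant \<phi> \<xi>' \<eta>'" for \<xi>' \<eta>'
  proof (rule key)
    show "outer_approximant \<phi> \<xi>' \<eta>'" "max_radial_error \<phi> \<xi>' \<eta>' \<le> M"
      using that outer order_trans[OF _ M_ge] unfolding optimal_outer_approximant_def by blast+
  qed
  then have "optimal_outer_approximant \<phi> \<xi>' \<eta>' \<longleftrightarrow> \<xi>' = \<xi> \<and> \<eta>' = \<eta>" for \<xi>' \<eta>'
    using opt by blast
  then show ?thesis by auto
qed

section \<open>Existence of the extremal parameters\<close>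

text \<open>The hypotheses pin down \<open>r = 2 sqrt 2 - 2\<close> and
  \<open>d = k_const / 8\<close>; the decimals supply the margins for the existence proof.\<close>

lemma extremal_constants:
  fixes r d :: real
  assumes r: "r\<^sup>2 = 4 - 4 * r" "0 < r" and d: "0 < d" "16 * d\<^sup>2 * (3 + r) = 1"
  shows "0.828 < r" "r < 0.829" "0.1277 < d" "d < 0.1278"
proof -
  have r': "(r + 2)\<^sup>2 = 8" using r(1) by algebra
  have "2.828\<^sup>2 < (r + 2)\<^sup>2" unfolding r' by (simp add: power2_eq_square)
  then have "2.828 < r + 2" by (rule power2_less_imp_less) (use r(2) in simp)
  then show r1: "0.828 < r" by simp
  have "(r + 2)\<^sup>2 < 2.829\<^sup>2" unfolding r' by (simp add: power2_eq_square)
  then have "r + 2 < 2.829" by (rule power2_less_imp_less) simp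
  then show r2: "r < 0.829" by simp
  have d': "d\<^sup>2 = 1 / (16 * (3 + r))" using d(2) r(2) by (simp add: field_simps)
  have "0.1277\<^sup>2 < d\<^sup>2"
    unfolding d' using r(2) r2 by (simp add: power2_eq_square field_simps)
  then show "0.1277 < d" by (rule power2_less_imp_less) (use d(1) in simp)
  have "d\<^sup>2 < 0.1278\<^sup>2"
    unfolding d' using r(2) r1 by (simp add: power2_eq_square field_simps)
  then show "d < 0.1278" by (rule power2_less_imp_less) simp
qed

text \<open>
  Here \<open>m\<close> and \<open>d\<close> are the scaled \<open>\<xi>\<close> and \<open>D\<close> at \<open>u = u_tilde\<close>. For \<open>c = 0\<close> the root is exactly
  \<open>m = d (6 + r) = 1 - l0\<close> and \<open>G = 0\<close>; the summand \<open>c / 100\<close> in \<open>l\<close> makes \<open>1 - l (1 - c)\<close> a lower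
  bound for \<open>m\<close> also near \<open>c = 1\<close>, where \<open>m = 1 - d (1 - c) + \<dots>\<close> and \<open>l0\<close> is slightly below \<open>d\<close>.
\<close>

lemma error_gap_at_upper_end:
  fixes c d m r :: real
  assumes c: "0 \<le> c" "c < 1" and r: "r\<^sup>2 = 4 - 4 * r" "0 < r"
    and d: "0 < d" "16 * d\<^sup>2 * (3 + r) = 1" and m: "0 \<le> m"
    and eq: "m\<^sup>2 + c * (1 + c) * m
      = 3 / 4 * (1 + c)\<^sup>2 + (1 - c) ^ 3 * (1 + c) * (d\<^sup>2 * r\<^sup>2) - 2 * c * (1 + c) * (1 - c) * d"
  defines "G \<equiv> 2 * (1 - c)\<^sup>2 * (1 + c) * m * d + 2 * (1 - c) ^ 3 * (1 + c) * d\<^sup>2 * r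
      - ((1 + c) / 2 - c * m)\<^sup>2"
  shows "0 \<le> G" and "0 < c \<Longrightarrow> 0 < G"
proof -
  note const = extremal_constants[OF r d]
  define \<kappa> l0 l where "\<kappa> = d\<^sup>2 * r\<^sup>2" and "l0 = 1 - d * (6 + r)" and "l = l0 + c / 100"
  have "d * (6 + r) \<le> 0.1278 * 6.829" "0.1277 * 6.828 \<le> d * (6 + r)"
    using const by (intro mult_mono; simp)+
  then have l0: "0.127 < l0" "l0 < 0.1281" unfolding l0_def by simp_all
  have d2: "d\<^sup>2 \<le> 0.1278\<^sup>2" using const by (intro power_mono) auto
  have "\<kappa> \<le> 0.1278\<^sup>2 * 0.829\<^sup>2"
    unfolding \<kappa>_def using const by (intro mult_mono power_mono) auto
  then have \<kappa>: "0 \<le> \<kappa>" "\<kappa> < 0.0113" unfolding \<kappa>_def by (simp_all add: power2_eq_square)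
  have dr: "d\<^sup>2 * r \<le> 0.1278\<^sup>2 * 0.829" using const d2 by (intro mult_mono) auto
  have l: "0.127 < l" "l < 0.1381" unfolding l_def using l0 c by auto
  \<comment> \<open>\<open>id1\<close> and \<open>id2\<close> are the equations \<open>eq\<close>
    and \<open>G = 0\<close> at \<open>c = 0\<close>, \<open>m = 1 - l0\<close>. They cancel the
    constant terms below, so that a factor \<open>c\<close> comes out.\<close>
  have id1: "l0\<^sup>2 - 2 * l0 = \<kappa> - 1 / 4"
  proof -
    have "d\<^sup>2 * (3 + r) = 1 / 16" using d by simp
    then have "d\<^sup>2 * (36 + 12 * r) = 3 / 4" by (simp add: algebra_simps)
    then show ?thesis unfolding l0_def \<kappa>_def by (simp add: power2_eq_square algebra_simps)
  qed
  have id2: "2 * d * (1 - l0) + 2 * d\<^sup>2 * r = 1 / 4"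
    using d(2) unfolding l0_def by (simp add: power2_eq_square algebra_simps)
  define m0 where "m0 = 1 - l * (1 - c)"
  have c2: "c\<^sup>2 \<le> 1" using c by (simp add: power_le_one)
  \<comment> \<open>The cofactor of \<open>c * (1 - c)\<close> when the left-hand side of
    \<open>eq\<close> at \<open>m\<close> is subtracted from that at \<open>m0\<close>. As this side
    increases on nonnegative arguments, \<open>b1 \<le> 0\<close> yields
    \<open>m0 \<le> m\<close>.\<close>
  define b1 where "b1 = - 1 / 4 - 2 / 100 + (2 * l0 / 100 + c / 10000) * (1 - c) - l0\<^sup>2
    + (1 + c) * (2 * d - l) + \<kappa> * (1 + c - c\<^sup>2)"
  have "(2 * l0 / 100 + c / 10000) * (1 - c) \<le> (2 * 0.1281 / 100 + 1 / 10000) * 1"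
    using c l0 by (intro mult_mono) auto
  moreover have "0.127\<^sup>2 \<le> l0\<^sup>2" using l0 by (intro power_mono) auto
  moreover have "(1 + c) * (2 * d - l) \<le> 2 * 0.1286" using c l const by (intro mult_mono) auto
  moreover have "\<kappa> * (1 + c - c\<^sup>2) \<le> 0.0113 * (5 / 4)"
  proof (intro mult_mono)
    have "0 \<le> (c - 1 / 2)\<^sup>2" by simp
    then show "1 + c - c\<^sup>2 \<le> 5 / 4" by (simp add: power2_eq_square algebra_simps)
  qed (use c c2 \<kappa> in auto)
  ultimately have b1: "b1 \<le> 0" unfolding b1_def by (simp add: power2_eq_square)
  have "m0\<^sup>2 + c * (1 + c) * m0 - (m\<^sup>2 + c * (1 + c) * m)
      = (1 - c) * (l0\<^sup>2 - 2 * l0 - (\<kappa> - 1 / 4) + c * b1)"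
    unfolding eq \<kappa>_def[symmetric] unfolding m0_def b1_def l_def
    by (simp add: power2_eq_square power3_eq_cube field_simps)
  also have "\<dots> = (1 - c) * (c * b1)" using id1 by simp
  also have "\<dots> \<le> 0" using c b1 by (simp add: mult_le_0_iff)
  finally have m0_le: "m0 \<le> m"
  proof (rule contrapos_pp)
    assume "\<not> m0 \<le> m"
    then have "m\<^sup>2 < m0\<^sup>2" "c * (1 + c) * m \<le> c * (1 + c) * m0"
      using m c by (auto intro!: power_strict_mono mult_left_mono)
    then show "\<not> m0\<^sup>2 + c * (1 + c) * m0 - (m\<^sup>2 + c * (1 + c) * m) \<le> 0" by linarith
  qed
  \<comment> \<open>Makes \<open>(1 + c) / 2 - c * m\<close> nonnegative, so that a bound on it may
    be squared. At \<open>1\<close> the left-hand side of \<open>eq\<close> is no smaller than the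
    right.\<close>
  have m_le: "m \<le> 1"
  proof (rule ccontr)
    assume "\<not> m \<le> 1"
    then have "1\<^sup>2 < m\<^sup>2" by (intro power_strict_mono) auto
    moreover have "c * (1 + c) * 1 \<le> c * (1 + c) * m"
      using \<open>\<not> m \<le> 1\<close> c by (intro mult_left_mono) auto
    ultimately have gt: "1 + c * (1 + c) < m\<^sup>2 + c * (1 + c) * m" by simp
    have "1 + c * (1 + c) - (m\<^sup>2 + c * (1 + c) * m)
        = (1 - c)\<^sup>2 * (1 / 4 - \<kappa> * (1 - c\<^sup>2)) + 2 * c * (1 + c) * (1 - c) * d"
      unfolding eq \<kappa>_def[symmetric] by (simp add: power2_eq_square power3_eq_cube field_simps)
    moreover have "\<kappa> * (1 - c\<^sup>2) \<le> \<kappa> * 1" using \<kappa> by (intro mult_left_mono) auto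
    then have "0 \<le> (1 - c)\<^sup>2 * (1 / 4 - \<kappa> * (1 - c\<^sup>2))" using \<kappa> by simp
    moreover have "0 \<le> 2 * c * (1 + c) * (1 - c) * d" using c d by simp
    ultimately show False using gt by linarith
  qed
  \<comment> \<open>The cofactor of \<open>c * (1 - c)\<^sup>2\<close> in the lower bound for
    \<open>G\<close> obtained from \<open>m0 \<le> m\<close>.\<close>
  define b2 where "b2 = 2 * d * (1 - l0) + 2 * d * (1 + c) * (l0 - (1 - c) / 100)
    - 2 * c * (d\<^sup>2 * r) - l - c * l\<^sup>2"
  have "0.1277 * 0.8719 \<le> d * (1 - l0)" using const l0 by (intro mult_mono) auto
  moreover have "0.117 \<le> l0 - (1 - c) / 100" using l0 c by (simp add: field_simps)
  then have "(0.1277 * 1) * 0.117 \<le> (d * (1 + c)) * (l0 - (1 - c) / 100)"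
    using const c by (intro mult_mono) auto
  moreover have "c * (d\<^sup>2 * r) \<le> 1 * (0.1278\<^sup>2 * 0.829)" using c r by (intro mult_mono[OF _ dr]) auto
  moreover have "c * l\<^sup>2 \<le> 1 * 0.1381\<^sup>2" using c l by (intro mult_mono power_mono) auto
  ultimately have b2: "0 < b2" unfolding b2_def using l by (simp add: power2_eq_square)
  have cm: "c * m \<le> c * 1" "c * m0 \<le> c * m" using m_le m0_le c by (intro mult_left_mono; simp)+
  have "0 \<le> (1 + c) / 2 - c * m" using cm(1) c by (simp add: field_simps)
  moreover have "(1 + c) / 2 - c * m0 = (1 - c) * (1 / 2 + c * l)"
    unfolding m0_def by (simp add: field_simps)
  then have "(1 + c) / 2 - c * m \<le> (1 - c) * (1 / 2 + c * l)" using cm(2) by linarith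
  ultimately have 1: "((1 + c) / 2 - c * m)\<^sup>2 \<le> (1 - c)\<^sup>2 * (1 / 2 + c * l)\<^sup>2"
    by (metis power_mono power_mult_distrib)
  have 2: "2 * (1 - c)\<^sup>2 * (1 + c) * d * m0 \<le> 2 * (1 - c)\<^sup>2 * (1 + c) * d * m"
    using m0_le c d by (intro mult_left_mono) auto
  have bracket: "2 * d * (1 + c) * m0 + 2 * (1 - c\<^sup>2) * (d\<^sup>2 * r) - (1 / 2 + c * l)\<^sup>2
      = 2 * d * (1 - l0) + 2 * d\<^sup>2 * r - 1 / 4 + c * b2"
  proof -
    have "(1 / 2 + c * l)\<^sup>2 = 1 / 4 + c * (l + c * l\<^sup>2)"
      by (simp add: power2_eq_square field_simps)
    moreover have "(1 + c) * m0 = 1 - l0 + c * ((1 + c) * (l0 - (1 - c) / 100) + 1 - l0)"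
      unfolding m0_def l_def by (simp add: field_simps)
    ultimately show ?thesis unfolding b2_def
      by (simp only: mult.assoc) (simp add: power2_eq_square algebra_simps)
  qed
  have "2 * (1 - c)\<^sup>2 * (1 + c) * d * m0 + 2 * (1 - c) ^ 3 * (1 + c) * d\<^sup>2 * r
      - (1 - c)\<^sup>2 * (1 / 2 + c * l)\<^sup>2
      = (1 - c)\<^sup>2 * (2 * d * (1 + c) * m0 + 2 * (1 - c\<^sup>2) * (d\<^sup>2 * r) - (1 / 2 + c * l)\<^sup>2)"
    by algebra
  also have "\<dots> = (1 - c)\<^sup>2 * (c * b2)" unfolding bracket using id2 by simp
  finally have G: "(1 - c)\<^sup>2 * (c * b2) \<le> G"
    unfolding G_def using 1 2 by (simp add: mult_ac)
  moreover have "0 \<le> (1 - c)\<^sup>2 * (c * b2)" using c b2 by simp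
  ultimately show "0 \<le> G" by linarith
  assume "0 < c"
  then have "0 < (1 - c)\<^sup>2 * (c * b2)" using c b2 by simp
  with G show "0 < G" by linarith
qed

text \<open>The equations compare the coefficients of \<open>1\<close> and \<open>q\<close> in
  \<open>quot = D\<^sup>2 (q - r)\<^sup>2\<close> after scaling. The first is solved for its
  positive root \<open>m x\<close>; the second becomes \<open>G x = 0\<close>, and \<open>G\<close>
  changes sign on \<open>[0, d]\<close>. At \<open>c = 0\<close> the gap \<open>G d\<close>
  vanishes, hence \<open>x < d\<close> only for \<open>0 < c\<close>.\<close>

lemma reduced_system_solvable:
  fixes c d r :: real
  assumes c: "0 \<le> c" "c < 1" and r: "r\<^sup>2 = 4 - 4 * r" "0 < r"
    and d: "0 < d" "16 * d\<^sup>2 * (3 + r) = 1"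
  obtains m x where "0 < m" "0 < x" "x \<le> d" "0 < c \<Longrightarrow> x < d"
    and "m\<^sup>2 + c * (1 + c) * m
      = 3 / 4 * (1 + c)\<^sup>2 + (1 - c) ^ 3 * (1 + c) * (x\<^sup>2 * r\<^sup>2) - 2 * c * (1 + c) * (1 - c) * x"
    and "2 * (1 - c)\<^sup>2 * (1 + c) * m * x + 2 * (1 - c) ^ 3 * (1 + c) * x\<^sup>2 * r
      = ((1 + c) / 2 - c * m)\<^sup>2"
proof -
  note const = extremal_constants[OF r d]
  define R where "R x = 3 / 4 * (1 + c)\<^sup>2 + (1 - c) ^ 3 * (1 + c) * (x\<^sup>2 * r\<^sup>2)
    - 2 * c * (1 + c) * (1 - c) * x" for x
  define b where "b = c * (1 + c)"
  define m where "m x = (sqrt (b\<^sup>2 + 4 * R x) - b) / 2" for x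
  define G where "G x = 2 * (1 - c)\<^sup>2 * (1 + c) * m x * x + 2 * (1 - c) ^ 3 * (1 + c) * x\<^sup>2 * r
    - ((1 + c) / 2 - c * m x)\<^sup>2" for x
  have b: "0 \<le> b" using c by (simp add: b_def)
  have R: "0 < R x" if "0 \<le> x" "x \<le> d" for x
  proof -
    have "(c * (1 - c)) * x \<le> 1 * 0.1278"
      using c that const by (intro mult_mono mult_le_one) auto
    then have "0 < (1 + c) * (3 / 4 * (1 + c) - 2 * (c * (1 - c) * x))" using c by simp
    moreover have "0 \<le> (1 - c) ^ 3 * (1 + c) * (x\<^sup>2 * r\<^sup>2)" using c by simp
    moreover have "R x = (1 + c) * (3 / 4 * (1 + c) - 2 * (c * (1 - c) * x))
        + (1 - c) ^ 3 * (1 + c) * (x\<^sup>2 * r\<^sup>2)"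
      unfolding R_def by (simp add: power2_eq_square algebra_simps)
    ultimately show ?thesis by linarith
  qed
  have m: "0 < m x" "(m x)\<^sup>2 + b * m x = R x" if "0 \<le> x" "x \<le> d" for x
  proof -
    have "b < sqrt (b\<^sup>2 + 4 * R x)" using R[OF that] by (intro real_less_rsqrt) simp
    then show "0 < m x" unfolding m_def by simp
    define w where "w = sqrt (b\<^sup>2 + 4 * R x)"
    have "w\<^sup>2 = b\<^sup>2 + 4 * R x" unfolding w_def using R[OF that] by simp
    moreover have "(m x)\<^sup>2 + b * m x = (w\<^sup>2 - b\<^sup>2) / 4"
      unfolding m_def w_def[symmetric] by (simp add: power2_eq_square field_simps)
    ultimately show "(m x)\<^sup>2 + b * m x = R x" by simp
  qed
  have "continuous_on {0..d} G" unfolding G_def m_def R_def by (auto intro!: continuous_intros)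
  moreover have "G 0 \<le> 0" unfolding G_def by simp
  moreover have Gd: "0 \<le> G d" "0 < c \<Longrightarrow> 0 < G d"
    using error_gap_at_upper_end[OF c r d, of "m d"] m[of d] d
    unfolding G_def R_def b_def by auto
  ultimately obtain x where x: "0 \<le> x" "x \<le> d" "G x = 0"
    using IVT'[of G 0 0 d] d by auto
  have "x \<noteq> 0"
  proof
    assume "x = 0"
    then have "(1 + c) / 2 = c * m 0" "(m 0)\<^sup>2 + c * (1 + c) * m 0 = 3 / 4 * (1 + c)\<^sup>2"
      using x m[of 0] d unfolding G_def R_def b_def by auto
    then have "(1 + c)\<^sup>2 * (1 - c\<^sup>2) = 0" by algebra
    then show False using c by (simp add: power2_eq_1_iff)
  qed
  moreover have "0 < c \<Longrightarrow> x \<noteq> d" using x Gd by auto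
  ultimately show ?thesis
    using m[OF x(1,2)] x(1,3) unfolding G_def R_def b_def
    by (intro that[of "m x" x]) (use x in auto)
qed

lemma extremal_parameters_exist:
  fixes c s d r :: real
  assumes cs: "0 \<le> c" "0 < s" "c\<^sup>2 + s\<^sup>2 = 1" and r: "r\<^sup>2 = 4 - 4 * r" "0 < r"
    and d: "0 < d" "16 * d\<^sup>2 * (3 + r) = 1"
  obtains \<xi> D where "0 < \<xi>" "0 < D" "D \<le> d * (1 - c)\<^sup>2" "0 < c \<Longrightarrow> D < d * (1 - c)\<^sup>2"
    and "\<And>q. quot c s \<xi> D q = D\<^sup>2 * (q - r)\<^sup>2"
proof -
  have "c\<^sup>2 < 1" using cs(2,3) by (smt (verit) zero_less_power2)
  then have c1: "c < 1" using cs by (simp add: abs_square_less_1)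
  define e where "e = 1 - c"
  have e: "0 < e" using c1 by (simp add: e_def)
  obtain m x where m: "0 < m" and x: "0 < x" "x \<le> d" "0 < c \<Longrightarrow> x < d"
    and eq1: "m\<^sup>2 + c * (1 + c) * m
      = 3 / 4 * (1 + c)\<^sup>2 + e ^ 3 * (1 + c) * (x\<^sup>2 * r\<^sup>2) - 2 * c * (1 + c) * e * x"
    and eq2: "2 * e\<^sup>2 * (1 + c) * m * x + 2 * e ^ 3 * (1 + c) * x\<^sup>2 * r = ((1 + c) / 2 - c * m)\<^sup>2"
    unfolding e_def using reduced_system_solvable[OF cs(1) c1 r d] by metis
  define \<xi> D where "\<xi> = e * m / s" and "D = e\<^sup>2 * x"
  have s2: "s\<^sup>2 = e * (1 + c)" unfolding e_def using cs(3) by (simp add: power2_eq_square algebra_simps)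
  have sx: "s * \<xi> = e * m" using cs unfolding \<xi>_def by simp
  \<comment> \<open>After multiplication by \<open>s\<^sup>2\<close>, only
    \<open>s * \<xi> = e * m\<close> and \<open>s\<^sup>2 = e * (1 + c)\<close> occur.\<close>
  have "s\<^sup>2 * (\<xi>\<^sup>2 + c * s * \<xi> + 2 * c * D - 3 * s\<^sup>2 / 4)
      = (s * \<xi>)\<^sup>2 + c * s\<^sup>2 * (s * \<xi>) + 2 * c * D * s\<^sup>2 - 3 / 4 * (s\<^sup>2)\<^sup>2"
    by (simp add: power2_eq_square algebra_simps)
  also have "\<dots> = e\<^sup>2 * (m\<^sup>2 + c * (1 + c) * m - 3 / 4 * (1 + c)\<^sup>2 + 2 * c * (1 + c) * e * x)"
    unfolding sx s2 D_def by (simp add: power2_eq_square algebra_simps)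
  also have "\<dots> = s\<^sup>2 * (D\<^sup>2 * r\<^sup>2)"
    unfolding eq1 s2 D_def by (simp add: power2_eq_square power3_eq_cube algebra_simps)
  finally have A: "\<xi>\<^sup>2 + c * s * \<xi> + 2 * c * D - 3 * s\<^sup>2 / 4 = D\<^sup>2 * r\<^sup>2" using cs by simp
  have "s\<^sup>2 * (2 * s * \<xi> * D - (s / 2 - c * \<xi>)\<^sup>2)
      = 2 * s\<^sup>2 * (s * \<xi>) * D - (s\<^sup>2 / 2 - c * (s * \<xi>))\<^sup>2"
    by (simp add: power2_eq_square field_simps)
  also have "\<dots> = e\<^sup>2 * (2 * e\<^sup>2 * (1 + c) * m * x - ((1 + c) / 2 - c * m)\<^sup>2)"
    unfolding sx s2 D_def by (simp add: power2_eq_square field_simps)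
  also have "\<dots> = s\<^sup>2 * (- 2 * D\<^sup>2 * r)"
    unfolding eq2[symmetric] s2 D_def by (simp add: power2_eq_square power3_eq_cube algebra_simps)
  finally have B: "2 * s * \<xi> * D - (s / 2 - c * \<xi>)\<^sup>2 = - 2 * D\<^sup>2 * r"
    by (rule mult_left_cancel[THEN iffD1, rotated]) (use cs in simp)
  show ?thesis
  proof (rule that)
    show "0 < \<xi>" "0 < D" using e m x cs unfolding \<xi>_def D_def by simp_all
    show "D \<le> d * (1 - c)\<^sup>2" unfolding D_def e_def using x by (subst mult.commute) (simp add: mult_right_mono)
    show "0 < c \<Longrightarrow> D < d * (1 - c)\<^sup>2" unfolding D_def using x e by (simp add: e_def)
    show "quot c s \<xi> D q = D\<^sup>2 * (q - r)\<^sup>2" for q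
      unfolding quot_def A B by (simp add: power2_eq_square algebra_simps)
  qed
qed

section \<open>The algebraic system\<close>

lemma has_field_derivative_psi:
  fixes \<phi> \<xi> \<eta> t :: real
  defines "c \<equiv> cos \<phi>" and "s \<equiv> sin \<phi>" and "D \<equiv> quad_coeff \<phi> \<xi> \<eta>" and "q \<equiv> 1 - t\<^sup>2"
  shows "((\<lambda>t. psi \<phi> t \<xi> \<eta>) has_field_derivative
    - 2 * t * q * (2 * quot c s \<xi> D q + q * (2 * s * \<xi> * D - (s / 2 - c * \<xi>)\<^sup>2 + 2 * D\<^sup>2 * q))) (at t)"
  unfolding psi_eq_quot assms quot_def
  by (rule derivative_eq_intros refl | simp)+ (simp add: power2_eq_square field_simps)

text \<open>As \<open>t\<close> and \<open>q\<close> are nonzero, a double zero of \<psi> in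
  \<open>t\<close> is a double zero of \<open>quot\<close> in \<open>q\<close>, and the leading
  coefficient \<open>D\<^sup>2\<close> then fixes the quadratic.\<close>

lemma psi_system_iff:
  fixes \<phi> \<xi> \<eta> t :: real
  defines "c \<equiv> cos \<phi>" and "s \<equiv> sin \<phi>" and "D \<equiv> quad_coeff \<phi> \<xi> \<eta>"
  assumes t: "t \<noteq> 0" "t\<^sup>2 \<noteq> 1"
  shows "psi \<phi> t \<xi> \<eta> = 0 \<and> deriv (\<lambda>t. psi \<phi> t \<xi> \<eta>) t = 0
    \<longleftrightarrow> (\<forall>q. quot c s \<xi> D q = D\<^sup>2 * (q - (1 - t\<^sup>2))\<^sup>2)"
proof -
  define r where "r = 1 - t\<^sup>2"
  define A B where "A = \<xi>\<^sup>2 + c * s * \<xi> + 2 * c * D - 3 * s\<^sup>2 / 4"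
    and "B = 2 * s * \<xi> * D - (s / 2 - c * \<xi>)\<^sup>2"
  have r: "r \<noteq> 0" using t by (simp add: r_def)
  have Q: "quot c s \<xi> D q = A + B * q + D\<^sup>2 * q\<^sup>2" for q
    unfolding quot_def A_def B_def by simp
  have "psi \<phi> t \<xi> \<eta> = 0 \<longleftrightarrow> quot c s \<xi> D r = 0"
    unfolding psi_eq_quot using r by (simp add: c_def s_def D_def r_def)
  moreover have "deriv (\<lambda>t. psi \<phi> t \<xi> \<eta>) t
      = - 2 * t * r * (2 * quot c s \<xi> D r + r * (B + 2 * D\<^sup>2 * r))"
    using DERIV_imp_deriv[OF has_field_derivative_psi, of \<phi> \<xi> \<eta> t]
    unfolding B_def c_def s_def D_def r_def by simp
  ultimately have "psi \<phi> t \<xi> \<eta> = 0 \<and> deriv (\<lambda>t. psi \<phi> t \<xi> \<eta>) t = 0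
      \<longleftrightarrow> quot c s \<xi> D r = 0 \<and> B + 2 * D\<^sup>2 * r = 0"
    using t r by auto
  also have "\<dots> \<longleftrightarrow> (\<forall>q. quot c s \<xi> D q = D\<^sup>2 * (q - r)\<^sup>2)"
  proof
    assume "quot c s \<xi> D r = 0 \<and> B + 2 * D\<^sup>2 * r = 0"
    then have "A + B * r + D\<^sup>2 * r\<^sup>2 = 0" "B + 2 * D\<^sup>2 * r = 0" unfolding Q by auto
    then show "\<forall>q. quot c s \<xi> D q = D\<^sup>2 * (q - r)\<^sup>2" unfolding Q by algebra
  next
    assume *: "\<forall>q. quot c s \<xi> D q = D\<^sup>2 * (q - r)\<^sup>2"
    then have "A + B * 0 + D\<^sup>2 * 0\<^sup>2 = D\<^sup>2 * (0 - r)\<^sup>2" "A + B * r + D\<^sup>2 * r\<^sup>2 = D\<^sup>2 * (r - r)\<^sup>2"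
      unfolding Q by blast+
    then have "A = D\<^sup>2 * r\<^sup>2" "A + B * r + D\<^sup>2 * r\<^sup>2 = 0" by simp_all
    then have "r * (B + 2 * D\<^sup>2 * r) = 0" by algebra
    then show "quot c s \<xi> D r = 0 \<and> B + 2 * D\<^sup>2 * r = 0" using r * by simp
  qed
  finally show ?thesis unfolding r_def .
qed

text \<open>With \<open>D = (u - 3 c) / 8\<close> and \<open>d = k_const / 8\<close>, the bound
  \<open>u \<le> u_tilde\<close> reads \<open>D \<le> d (1 - c)\<^sup>2\<close>.\<close>

lemma u_tilde_eq: "u_tilde \<phi> = 3 * cos \<phi> + k_const * (1 - cos \<phi>)\<^sup>2"
  unfolding u_tilde_def by (simp add: power2_eq_square algebra_simps)

text \<open>Here \<open>E\<close> is \<open>s \<xi> = (v - u) / 8\<close>, and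
  \<open>1 - c \<le> E + D\<close> encodes \<open>8 - 5 c \<le> v\<close>. The result supplies the
  hypothesis \<open>D_le\<close> of \<open>quot_exchange\<close> throughout the domain.\<close>

lemma domain_parameter_bound:
  fixes c s d E D :: real
  assumes cs: "0 \<le> c" "0 < s" "c\<^sup>2 + s\<^sup>2 = 1" and d: "0 < d" "d < 1 / 2"
    and D: "0 < D" "D \<le> d * (1 - c)\<^sup>2" and E: "1 - c \<le> E + D"
  shows "D \<le> E / s\<^sup>2 - c / 2" and "0 < E"
proof -
  have "c\<^sup>2 < 1" using cs(2,3) by (smt (verit) zero_less_power2)
  then have c1: "c < 1" using cs by (simp add: abs_square_less_1)
  define e where "e = 1 - c"
  have e: "0 < e" "e \<le> 1" "c = 1 - e" using c1 cs by (simp_all add: e_def)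
  have s2: "s\<^sup>2 = e * (1 + c)" unfolding e_def using cs(3) by (simp add: power2_eq_square algebra_simps)
  have s2_le: "s\<^sup>2 \<le> 1" using cs(3) zero_le_power2[of c] by linarith
  have De: "D \<le> d * e * e" using D by (simp add: e_def power2_eq_square)
  have "d * e \<le> 1 / 2 * e" using d e by (intro mult_right_mono) auto
  then have de: "2 * (d * e) \<le> e" by simp
  \<comment> \<open>The aim is \<open>(D + c / 2) * (1 + c) + d * e \<le> 1\<close>. Multiplied by
    \<open>e\<close> it gives
    \<open>(D + c / 2) * s\<^sup>2 + d * e\<^sup>2 \<le> e \<le> E + D\<close>, where
    \<open>D \<le> d * e\<^sup>2\<close>.\<close>
  have "D * (1 + c) \<le> d * e * e * (1 + c)" using De cs by (intro mult_right_mono) auto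
  also have "\<dots> = d * e * s\<^sup>2" unfolding s2 by simp
  also have "\<dots> \<le> d * e" using d e s2_le by (intro mult_left_le) auto
  finally have "D * (1 + c) \<le> d * e" .
  moreover have "c * (1 + c) \<le> c * 2" using cs c1 by (intro mult_left_mono) auto
  moreover have "(D + c / 2) * (1 + c) = D * (1 + c) + c * (1 + c) / 2"
    by (simp add: field_simps)
  ultimately have "(D + c / 2) * (1 + c) + d * e \<le> 1" using de e(3) by linarith
  then have "e * ((D + c / 2) * (1 + c) + d * e) \<le> e * 1" using e by (intro mult_left_mono) auto
  moreover have "(D + c / 2) * s\<^sup>2 = e * ((D + c / 2) * (1 + c) + d * e) - d * e * e"
    unfolding s2 by (simp add: algebra_simps)
  moreover have "e \<le> E + D" using E by (simp add: e_def)
  ultimately have *: "(D + c / 2) * s\<^sup>2 \<le> E" using De by linarith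
  then show "D \<le> E / s\<^sup>2 - c / 2" using cs by (simp add: field_simps)
  show "0 < E" using * D cs by (smt (verit) mult_pos_pos zero_less_power2 divide_nonneg_pos)
qed

theorem theorem7:
  fixes \<phi> :: real
  assumes "0 < \<phi>" and "\<phi> \<le> pi / 2"
  shows "\<exists>u v.
    {(u', v'). (u', v') \<in> solution_domain \<phi> \<and>
               psi_uv \<phi> (sqrt 2 - 1) u' v' = 0 \<and>
               deriv (\<lambda>t. psi_uv \<phi> t u' v') (sqrt 2 - 1) = 0} = {(u, v)} \<and>
    {(\<xi>, \<eta>). optimal_outer_approximant \<phi> \<xi> \<eta>} = {(xi_of \<phi> u v, eta_of u v)}"
proof -
  define c s where "c = cos \<phi>" and "s = sin \<phi>"
  define r :: real where "r = 2 * sqrt 2 - 2"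
  define d where "d = k_const / 8"
  have cs: "0 \<le> c" "0 < s" "c\<^sup>2 + s\<^sup>2 = 1"
    using assms by (auto simp: c_def s_def cos_ge_zero sin_gt_zero)
  have c_pos: "0 < c" if "\<phi> \<noteq> pi / 2"
    using assms that unfolding c_def by (intro cos_gt_zero) auto
  have sqrt2: "sqrt 2 * sqrt 2 = 2" "5 / 4 < sqrt 2" "sqrt 2 < 3 / 2"
    by (simp, rule real_less_rsqrt, simp add: power2_eq_square, rule real_less_lsqrt) (simp_all add: power2_eq_square)
  have r: "r\<^sup>2 = 4 - 4 * r" "0 < r" "r < 1" and t: "1 - (sqrt 2 - 1)\<^sup>2 = r"
    using sqrt2 by (simp_all add: r_def power2_eq_square algebra_simps)
  have "1 * 1 < 2 * sqrt 2" using sqrt2(2) by (intro mult_strict_mono) auto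
  then have "0 < (2 * sqrt 2 - 1) / 7" by simp
  then have k2: "k_const\<^sup>2 = 4 * ((2 * sqrt 2 - 1) / 7)" and k: "0 < k_const"
    unfolding k_const_def by (simp_all add: power_mult_distrib)
  have "16 * d\<^sup>2 * (3 + r) = k_const\<^sup>2 / 4 * (2 * sqrt 2 + 1)"
    unfolding d_def r_def by (simp add: power_divide)
  also have "\<dots> = (2 * sqrt 2 - 1) / 7 * (2 * sqrt 2 + 1)" unfolding k2 by simp
  also have "\<dots> = 1" using sqrt2(1) by (simp add: algebra_simps)
  finally have d: "0 < d" "16 * d\<^sup>2 * (3 + r) = 1" using k by (simp_all add: d_def)
  have d_half: "d < 1 / 2" using extremal_constants[OF r(1,2) d] by simp
  have root_s: "sqrt (1 - (cos \<phi>)\<^sup>2) = s"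
    using cs by (simp add: s_def sin_squared_eq[symmetric])
  have E: "s * xi_of \<phi> u v = (v - u) / 8" for u v
    using cs by (simp add: xi_of_def root_s)
  have D: "quad_coeff \<phi> (xi_of \<phi> u v) (eta_of u v) = (u - 3 * c) / 8" for u v
  proof -
    have "4 * xi_of \<phi> u v * s = (v - u) / 2" using E[of u v] by (simp add: mult.commute)
    then show ?thesis unfolding quad_coeff_def eta_of_def c_def s_def by (simp add: field_simps)
  qed
  have sys: "psi_uv \<phi> (sqrt 2 - 1) u v = 0 \<and> deriv (\<lambda>t. psi_uv \<phi> t u v) (sqrt 2 - 1) = 0 \<longleftrightarrow>
      (\<forall>q. quot c s (xi_of \<phi> u v) ((u - 3 * c) / 8) q = ((u - 3 * c) / 8)\<^sup>2 * (q - r)\<^sup>2)" for u v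
    unfolding psi_uv_def using psi_system_iff[of "sqrt 2 - 1" \<phi> "xi_of \<phi> u v" "eta_of u v"] sqrt2 t r
    unfolding D c_def s_def by auto
  have opt: "{(\<xi>, \<eta>). optimal_outer_approximant \<phi> \<xi> \<eta>} = {(xi_of \<phi> u v, eta_of u v)}"
    if dom: "(u, v) \<in> solution_domain \<phi>" and root:
      "\<And>q. quot c s (xi_of \<phi> u v) ((u - 3 * c) / 8) q = ((u - 3 * c) / 8)\<^sup>2 * (q - r)\<^sup>2" for u v
  proof -
    define \<xi> Y where "\<xi> = xi_of \<phi> u v" and "Y = (u - 3 * c) / 8"
    have "3 * c < u" "u \<le> 3 * c + k_const * (1 - c)\<^sup>2" "8 - 5 * c \<le> v"
      using dom unfolding solution_domain_def u_tilde_eq c_def by (auto split: if_splits)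
    then have Y: "0 < Y" "Y \<le> d * (1 - c)\<^sup>2" "1 - c \<le> s * \<xi> + Y"
      using E[of u v] unfolding Y_def \<xi>_def d_def by (simp_all add: field_simps)
    note bound = domain_parameter_bound[OF cs d(1) d_half Y]
    have "s * \<xi> / s\<^sup>2 = \<xi> / s" using cs by (simp add: power2_eq_square)
    then have le: "Y \<le> \<xi> / s - c / 2" using bound(1) by simp
    have \<xi>: "0 < \<xi>" using bound(2) cs by (simp add: zero_less_mult_iff)
    have "quad_coeff \<phi> \<xi> (eta_of u v) = Y" unfolding \<xi>_def Y_def by (rule D)
    note unique = optimal_outer_unique[where \<phi> = \<phi> and \<xi> = \<xi> and \<eta> = "eta_of u v" and r = r,
        folded c_def s_def, unfolded this]
    show ?thesis
      using unique[OF cs(1,2) r \<xi> Y(1) le root[folded \<xi>_def Y_def]] unfolding \<xi>_def .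
  qed
  obtain \<xi> Y where \<xi>: "0 < \<xi>" and Y: "0 < Y" "Y \<le> d * (1 - c)\<^sup>2" "0 < c \<Longrightarrow> Y < d * (1 - c)\<^sup>2"
    and root: "\<And>q. quot c s \<xi> Y q = Y\<^sup>2 * (q - r)\<^sup>2"
    using extremal_parameters_exist[OF cs r(1,2) d] by metis
  define u v where "u = 8 * Y + 3 * c" and "v = 8 * s * \<xi> + u"
  have uv: "xi_of \<phi> u v = \<xi>" "(u - 3 * c) / 8 = Y"
    using cs unfolding xi_of_def root_s v_def u_def by simp_all
  \<comment> \<open>The curve point at \<open>t = 0\<close> is \<open>(c + s \<xi> + Y, 0)\<close>.
    It lies on or outside the circle since \<open>quot\<close> is a square at \<open>q = 1\<close>,
    and this is the bound on \<open>v\<close>.\<close>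
  have "(c + s * \<xi> + Y)\<^sup>2 = (c\<^sup>2 + s\<^sup>2) * (1 + \<xi>\<^sup>2) - \<xi>\<^sup>2 + quot c s \<xi> Y 1"
    unfolding quot_def by (simp add: power2_eq_square field_simps)
  then have "(c + s * \<xi> + Y)\<^sup>2 = 1 + quot c s \<xi> Y 1" unfolding cs(3) by simp
  then have "1\<^sup>2 \<le> (c + s * \<xi> + Y)\<^sup>2" unfolding root by simp
  then have "1 \<le> c + s * \<xi> + Y"
    by (rule power2_le_imp_le) (use cs(1,2) \<xi> Y(1) in simp)
  then have v: "8 - 5 * c \<le> v" unfolding v_def u_def by simp
  have dom: "(u, v) \<in> solution_domain \<phi>"
    using v Y c_pos unfolding solution_domain_def u_tilde_eq u_def d_def c_def by auto
  have root': "quot c s (xi_of \<phi> u v) ((u - 3 * c) / 8) q = ((u - 3 * c) / 8)\<^sup>2 * (q - r)\<^sup>2" for q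
    unfolding uv by (rule root)
  \<comment> \<open>By \<open>opt\<close> each solution in the domain describes the same singleton
    of optima, and \<open>(\<xi>, \<eta>)\<close> determines \<open>(u, v)\<close>.\<close>
  have "u' = u \<and> v' = v" if "(u', v') \<in> solution_domain \<phi>"
    "\<And>q. quot c s (xi_of \<phi> u' v') ((u' - 3 * c) / 8) q = ((u' - 3 * c) / 8)\<^sup>2 * (q - r)\<^sup>2" for u' v'
  proof -
    have "xi_of \<phi> u' v' = xi_of \<phi> u v" "eta_of u' v' = eta_of u v"
      using opt[OF that] opt[OF dom root'] by auto
    then have "v' - u' = v - u" "u' + v' = u + v"
      using E[of u' v'] E[of u v] by (simp_all add: eta_of_def)
    then show ?thesis by simp
  qed
  then have "(u', v') \<in> solution_domain \<phi> \<and> psi_uv \<phi> (sqrt 2 - 1) u' v' = 0 \<and>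
      deriv (\<lambda>t. psi_uv \<phi> t u' v') (sqrt 2 - 1) = 0 \<longleftrightarrow> u' = u \<and> v' = v" for u' v'
    unfolding sys using dom root' by blast
  then have "{(u', v'). (u', v') \<in> solution_domain \<phi> \<and>
               psi_uv \<phi> (sqrt 2 - 1) u' v' = 0 \<and>
               deriv (\<lambda>t. psi_uv \<phi> t u' v') (sqrt 2 - 1) = 0} = {(u, v)}"
    by auto
  with opt[OF dom root'] show ?thesis by blast
qed

end
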